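(* Let $G$ be a polygon circle graph with clique number $\omega$. Then the chromatic number of $G$ is at most $7\omega^4$.
   Context: A polygon circle graph is the intersection graph of a finite set of polygons inscribed in the unit circle: the vertices are the polygons (convex polygonal regions all of whose corners lie on the unit circle), and two distinct vertices are adjacent if and only if the corresponding polygons intersect. *)

theory Defs
  imports "HOL-Analysis.Analysis" "HOL-Library.Ramsey"
begin

text \<open>A finite simple graph is given by its vertex set \<open>V\<close> and its set \<open>E\<close> of edges, which are
  two-element subsets of \<open>V\<close>; cliques are those of theory \<open>HOL-Library.Ramsey\<close>.\<close>

definition proper_colouring :: "'a set \<Rightarrow> 'a set set \<Rightarrow> ('a \<Rightarrow> nat) \<Rightarrow> bool" where
  "proper_colouring V E c \<longleftrightarrow> (\<forall>u\<in>V. \<forall>v\<in>V. u \<noteq> v \<and> {u, v} \<in> E \<longrightarrow> c u \<noteq> c v)"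

definition chromatic_number :: "'a set \<Rightarrow> 'a set set \<Rightarrow> nat" where
  "chromatic_number V E = (LEAST k. \<exists>c. c ` V \<subseteq> {..<k} \<and> proper_colouring V E c)"

definition clique_number :: "'a set \<Rightarrow> 'a set set \<Rightarrow> nat" where
  "clique_number V E = Max {card K | K. K \<subseteq> V \<and> clique K E}"

text \<open>The plane is identified with the complex numbers. The corners of a convex polygonal region
  are its extreme points; nonempty interior means that there are at least three of them.\<close>

definition inscribed_polygon :: "complex set \<Rightarrow> bool" where
  "inscribed_polygon P \<longleftrightarrow>
     polytope P \<and> interior P \<noteq> {} \<and> {x. x extreme_point_of P} \<subseteq> sphere 0 1"

definition intersection_edges :: "'b set set \<Rightarrow> 'b set set set" where
  "intersection_edges \<P> = {{P, Q} | P Q. P \<in> \<P> \<and> Q \<in> \<P> \<and> P \<noteq> Q \<and> P \<inter> Q \<noteq> {}}"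

text \<open>As usual for intersection graphs, the vertices are identified with the polygons by an
  isomorphism \<open>f\<close>.\<close>

definition polygon_circle_graph :: "'a set \<Rightarrow> 'a set set \<Rightarrow> bool" where
  "polygon_circle_graph V E \<longleftrightarrow>
     (\<exists>\<P> f. finite \<P> \<and> (\<forall>P\<in>\<P>. inscribed_polygon P) \<and> bij_betw f V \<P> \<and>
        (\<forall>e\<in>E. e \<subseteq> V) \<and> (\<lambda>e. f ` e) ` E = intersection_edges \<P>)"

end

theory Submission
  imports Defs
begin

text \<open>Ordering the corners of all polygons by their arguments turns a polygon into the interval
  spanned by its corners. Polygons with overlapping intervals meet in a corner or in two chords;
  polygons with disjoint intervals do not meet. If \<open>u\<close> contains \<open>v\<close> and \<open>v\<close> contains \<open>x\<close> as intervals
  and \<open>u\<close> misses \<open>v\<close>, then all corners of \<open>u\<close> lie outside the interval of \<open>v\<close>, so the line through the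
  two extreme corners of \<open>v\<close> separates \<open>u\<close> from \<open>x\<close>. Hence in a family without overlaps the
  neighbours of a polygon with shortest interval form a clique, and greedy colouring needs only
  \<open>\<omega>\<close> colours.

  It remains to colour overlap graphs of intervals with \<open>10 \<omega>\<^sup>2\<close> colours. Intervals through a common
  point (a pillar) form a permutation graph and need \<open>\<omega>\<close> colours, so it suffices to assign pillars
  to intervals and to colour the pillars with \<open>10 \<omega>\<close> colours. Pillars are added recursively inside a
  segment such that intervals of at most \<open>8 \<omega>\<close> earlier pillars end in it: new pillars are placed
  greedily so that at most \<open>6 \<omega>\<close> of these are seen between any two neighbouring ones. As overlapping
  intervals are found along the diagonals of the incidence matrix of earlier pillars and cells, at
  most \<open>2 \<omega>\<close> new pillars are used, so that again at most \<open>8 \<omega>\<close> pillars are seen in each part. This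
  gives \<open>10 \<omega>\<^sup>3 \<le> 7 \<omega>\<^sup>4\<close> colours in total if \<open>\<omega> \<ge> 2\<close>.\<close>

section \<open>Colouring overlap graphs of intervals\<close>

text \<open>Mirsky's theorem. The colour of \<open>x\<close> is the size of a largest chain strictly
  below it. Adding \<open>x\<close> to that chain gives a larger chain in \<open>S\<close>, so the
  colour is less than \<open>w\<close>; this chain lies below every \<open>y\<close> with
  \<open>R x y\<close>, so colours increase along \<open>R\<close>.\<close>

lemma mirsky_colouring:
  fixes R :: "'a \<Rightarrow> 'a \<Rightarrow> bool"
  assumes "finite S"
    and trans: "\<And>x y z. R x y \<Longrightarrow> R y z \<Longrightarrow> R x z"
    and irrefl: "\<And>x. \<not> R x x"
    and chains: "\<And>K. K \<subseteq> S \<Longrightarrow> (\<And>x y. x \<in> K \<Longrightarrow> y \<in> K \<Longrightarrow> x \<noteq> y \<Longrightarrow> R x y \<or> R y x) \<Longrightarrow> card K \<le> w"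
  shows "\<exists>h :: 'a \<Rightarrow> nat. (\<forall>x\<in>S. h x < w) \<and> (\<forall>x\<in>S. \<forall>y\<in>S. R x y \<longrightarrow> h x < h y)"
proof -
  define chain where "chain K \<longleftrightarrow> (\<forall>x\<in>K. \<forall>y\<in>K. x \<noteq> y \<longrightarrow> R x y \<or> R y x)" for K
  define C where "C x = {K. K \<subseteq> {y\<in>S. R y x} \<and> chain K}" for x
  define h where "h x = Max (card ` C x)" for x
  have fin: "finite (C x)" for x
    by (rule finite_subset[of _ "Pow S"]) (use \<open>finite S\<close> in \<open>auto simp: C_def\<close>)
  have ne: "C x \<noteq> {}" for x
  proof -
    have "{} \<in> C x" by (auto simp: C_def chain_def)
    then show ?thesis by blast
  qed
  have ext: "h x < card (insert x K)" "insert x K \<subseteq> S" "chain (insert x K)"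
    if "x \<in> S" "K \<in> C x" "card K = h x" for x K
  proof -
    have "finite K" "x \<notin> K"
      using that \<open>finite S\<close> irrefl by (auto simp: C_def intro: finite_subset[of K S])
    then show "h x < card (insert x K)" using that by simp
    show "insert x K \<subseteq> S" "chain (insert x K)" using that by (auto simp: C_def chain_def)
  qed
  have ob: "\<exists>K\<in>C x. card K = h x" for x
  proof -
    have "h x \<in> card ` C x"
      unfolding h_def using fin ne by (intro Max_in) auto
    then show ?thesis by auto
  qed
  have "h x < w" if x: "x \<in> S" for x
  proof -
    obtain K where K: "K \<in> C x" "card K = h x" using ob by blast
    have "card (insert x K) \<le> w"
      using ext[OF x K] by (intro chains) (auto simp: chain_def)
    with ext(1)[OF x K] show ?thesis by simp
  qed
  moreover have "h x < h y" if x: "x \<in> S" and xy: "R x y" for x y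
  proof -
    obtain K where K: "K \<in> C x" "card K = h x" using ob by blast
    have "insert x K \<in> C y"
      using ext[OF x K] K xy trans by (fastforce simp: C_def)
    then have "card (insert x K) \<le> h y"
      unfolding h_def using fin by (intro Max_ge) auto
    with ext(1)[OF x K] show ?thesis by simp
  qed
  ultimately show ?thesis by blast
qed

text \<open>Intervals sharing a left end or a right end count as nested, whereas
  \<open>l y = r x\<close> can still be an overlap; hence two meeting intervals that do not overlap
  are nested. Positive left ends keep position 0 free as the border of the initial segment.\<close>

locale interval_family =
  fixes U :: "'a set" and l r :: "'a \<Rightarrow> nat" and w :: nat and ov :: "'a \<Rightarrow> 'a \<Rightarrow> bool"
  assumes ov_def: "ov x y \<longleftrightarrow> l x < l y \<and> l y \<le> r x \<and> r x < r y"
    and finite_U: "finite U"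
    and l_pos: "x \<in> U \<Longrightarrow> 0 < l x"
    and l_le_r: "x \<in> U \<Longrightarrow> l x \<le> r x"
    and w_pos: "0 < w"
    and clique_bound: "K \<subseteq> U \<Longrightarrow>
      (\<And>x y. x \<in> K \<Longrightarrow> y \<in> K \<Longrightarrow> x \<noteq> y \<Longrightarrow> ov x y \<or> ov y x) \<Longrightarrow> card K \<le> w"
begin

text \<open>For intervals through \<open>q\<close>, overlapping is the strict componentwise order of
  the endpoint pairs. Unlike \<open>ov\<close> in general it is transitive, and its chains are
  cliques.\<close>

lemma stabbed_colouring:
  "\<exists>h. (\<forall>x\<in>U. l x \<le> q \<longrightarrow> q \<le> r x \<longrightarrow> h x < w) \<and>
    (\<forall>x\<in>U. \<forall>y\<in>U. l x \<le> q \<longrightarrow> q \<le> r x \<longrightarrow> l y \<le> q \<longrightarrow> q \<le> r y \<longrightarrow> ov x y \<longrightarrow> h x \<noteq> (h y :: nat))"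
proof -
  let ?S = "{x\<in>U. l x \<le> q \<and> q \<le> r x}"
  have "\<exists>h :: 'a \<Rightarrow> nat. (\<forall>x\<in>?S. h x < w) \<and>
      (\<forall>x\<in>?S. \<forall>y\<in>?S. (l x < l y \<and> r x < r y) \<longrightarrow> h x < h y)"
  proof (rule mirsky_colouring)
    fix K
    assume K: "K \<subseteq> ?S" "\<And>x y. x \<in> K \<Longrightarrow> y \<in> K \<Longrightarrow> x \<noteq> y \<Longrightarrow> (l x < l y \<and> r x < r y) \<or> (l y < l x \<and> r y < r x)"
    show "card K \<le> w"
    proof (rule clique_bound)
      show "K \<subseteq> U" using K by auto
      fix x y assume "x \<in> K" "y \<in> K" "x \<noteq> y"
      then have "l x \<le> q" "q \<le> r x" "l y \<le> q" "q \<le> r y" using K(1) by auto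
      then show "ov x y \<or> ov y x"
        using K(2)[OF \<open>x \<in> K\<close> \<open>y \<in> K\<close> \<open>x \<noteq> y\<close>] by (auto simp: ov_def)
    qed
  qed (use finite_U in auto)
  then obtain h :: "'a \<Rightarrow> nat" where "\<forall>x\<in>?S. h x < w"
    "\<forall>x\<in>?S. \<forall>y\<in>?S. (l x < l y \<and> r x < r y) \<longrightarrow> h x < h y" by blast
  then show ?thesis
    by (intro exI[of _ h]) (fastforce simp: ov_def)
qed

text \<open>Every diagonal of the matrix is a clique.\<close>

lemma diagonal_count:
  fixes M :: "nat \<Rightarrow> nat \<Rightarrow> 'a set"
  assumes M: "\<And>i j. i < a \<Longrightarrow> M i j \<subseteq> U"
    and incr: "\<And>i i' j j' x y. i < i' \<Longrightarrow> i' < a \<Longrightarrow> j < j' \<Longrightarrow> j' < n \<Longrightarrow>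
      x \<in> M i j \<Longrightarrow> y \<in> M i' j' \<Longrightarrow> ov x y \<or> ov y x"
  shows "(\<Sum>j<n. card {i. i < a \<and> M i j \<noteq> {}}) \<le> w * (a + n)"
proof -
  \<comment> \<open>\<open>F d\<close> is a diagonal of constant \<open>i - j\<close>; the shift by
    \<open>n\<close> avoids negative indices, so that the values \<open>d < a + n\<close> cover the
    matrix.\<close>
  define F where "F d = {(j, i). i < a \<and> j < n \<and> M i j \<noteq> {} \<and> i + n = d + j}" for d
  have finF: "finite (F d)" for d
    by (rule finite_subset[of _ "{..<n} \<times> {..<a}"]) (auto simp: F_def)
  have F_le: "card (F d) \<le> w" for d
  proof -
    define x where "x = (\<lambda>(j, i). SOME x. x \<in> M i j)"
    have x: "x (j, i) \<in> M i j" if "M i j \<noteq> {}" for i j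
      unfolding x_def using that by (simp add: some_in_eq)
    have step: "ov (x e) (x e') \<or> ov (x e') (x e)" if "e \<in> F d" "e' \<in> F d" "e \<noteq> e'" for e e'
    proof -
      obtain j i j' i' where e: "e = (j, i)" "e' = (j', i')" by force
      with that have *: "i + n = d + j" "i' + n = d + j'" "i < a" "i' < a" "j < n" "j' < n"
        "x e \<in> M i j" "x e' \<in> M i' j'" "(j, i) \<noteq> (j', i')"
        using x by (auto simp: F_def)
      then consider "i < i'" "j < j'" | "i' < i" "j' < j" by fastforce
      then show ?thesis using incr * by cases blast+
    qed
    \<comment> \<open>Since \<open>ov\<close> is irreflexive, representatives of different cells of
      a diagonal differ.\<close>
    have "inj_on x (F d)"
      by (rule inj_onI) (use step in \<open>fastforce simp: ov_def\<close>)
    then have "card (F d) = card (x ` F d)" by (simp add: card_image)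
    also have "\<dots> \<le> w"
    proof (rule clique_bound)
      show "x ` F d \<subseteq> U" using x M by (fastforce simp: F_def)
    qed (use step in blast)
    finally show ?thesis .
  qed
  have "(\<Sum>j<n. card {i. i < a \<and> M i j \<noteq> {}}) = card (SIGMA j:{..<n}. {i. i < a \<and> M i j \<noteq> {}})"
    by (rule card_SigmaI[symmetric]) auto
  also have "\<dots> \<le> card (\<Union>d<a + n. F d)"
  proof (rule card_mono)
    show "(SIGMA j:{..<n}. {i. i < a \<and> M i j \<noteq> {}}) \<subseteq> (\<Union>d<a + n. F d)"
    proof (rule subrelI)
      fix j i assume "(j, i) \<in> (SIGMA j:{..<n}. {i. i < a \<and> M i j \<noteq> {}})"
      then have "(j, i) \<in> F (i + n - j)" "i + n - j < a + n" by (auto simp: F_def)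
      then show "(j, i) \<in> (\<Union>d<a + n. F d)" by blast
    qed
  qed (use finF in auto)
  also have "\<dots> \<le> (\<Sum>d<a + n. card (F d))" by (rule card_UN_le) auto
  also have "\<dots> \<le> (\<Sum>d<a + n. w)" using F_le by (intro sum_mono) auto
  finally show ?thesis by (simp add: mult.commute)
qed

section \<open>Segments, groups and pillars\<close>

definition inside :: "nat \<Rightarrow> nat \<Rightarrow> 'a set" where
  "inside s t = {x\<in>U. s < l x \<and> r x < t}"

text \<open>A group is a set of intervals stabbed by a common pillar outside the segment between \<open>s\<close>
  and \<open>t\<close>, together with the colour of this pillar.\<close>

definition left_groups :: "nat \<Rightarrow> ('a set \<times> nat) list \<Rightarrow> bool" where
  "left_groups s As \<longleftrightarrow> sorted_wrt (\<lambda>g h. \<forall>x\<in>fst g. \<forall>y\<in>fst h. l x < l y) As \<and>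
     (\<forall>g\<in>set As. fst g \<subseteq> {x\<in>U. l x \<le> s})"

definition right_groups :: "nat \<Rightarrow> ('a set \<times> nat) list \<Rightarrow> bool" where
  "right_groups t Bs \<longleftrightarrow> sorted_wrt (\<lambda>g h. \<forall>x\<in>fst g. \<forall>y\<in>fst h. r x < r y) Bs \<and>
     (\<forall>g\<in>set Bs. fst g \<subseteq> {x\<in>U. t \<le> r x})"

definition hits :: "('a \<Rightarrow> nat) \<Rightarrow> nat set \<Rightarrow> 'a set \<times> nat \<Rightarrow> bool" where
  "hits e T g \<longleftrightarrow> (\<exists>x\<in>fst g. e x \<in> T)"

text \<open>A left group can reach into the segment only with right ends, a right group only with
  left ends. The count is of those earlier pillars that can matter in \<open>T\<close>.\<close>

definition seen :: "('a set \<times> nat) list \<Rightarrow> ('a set \<times> nat) list \<Rightarrow> nat set \<Rightarrow> nat" where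
  "seen As Bs T = length (filter (hits r T) As) + length (filter (hits l T) Bs)"

text \<open>Here \<open>p x\<close> is the pillar of \<open>x\<close> and \<open>c x\<close> is the colour of this pillar.\<close>

definition pillar_colourable ::
  "nat \<Rightarrow> nat \<Rightarrow> nat \<Rightarrow> ('a set \<times> nat) list \<Rightarrow> ('a set \<times> nat) list \<Rightarrow> bool" where
  "pillar_colourable n s t As Bs \<longleftrightarrow> (\<exists>c p.
     (\<forall>x\<in>inside s t. c x < n \<and> l x \<le> p x \<and> p x \<le> r x) \<and>
     (\<forall>x\<in>inside s t. \<forall>y\<in>inside s t. ov x y \<longrightarrow> c x = c y \<longrightarrow> p x = p y) \<and>
     (\<forall>x\<in>inside s t. \<forall>g\<in>set As \<union> set Bs. \<forall>y\<in>fst g. ov x y \<or> ov y x \<longrightarrow> c x \<noteq> snd g))"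

lemma seen_mono: "T \<subseteq> T' \<Longrightarrow> seen As Bs T \<le> seen As Bs T'"
  unfolding seen_def hits_def length_filter_conv_card
  by (intro add_mono card_mono) auto

lemma seen_empty: "seen As Bs {} = 0"
  by (simp add: seen_def hits_def)

text \<open>If \<open>l y \<le> s\<close> and \<open>y\<close> overlaps some \<open>x\<close> inside
  the segment, then \<open>y\<close> must end strictly between \<open>s\<close> and
  \<open>t\<close>, as otherwise the two are disjoint or nested; dually on the right. So groups
  without an end in the open segment forbid no colour, and only visible groups need
  counting.\<close>

lemma pillar_colourable_visible:
  assumes "left_groups s As" "right_groups t Bs"
    and "pillar_colourable n s t (filter (hits r {s<..<t}) As) (filter (hits l {s<..<t}) Bs)"
  shows "pillar_colourable n s t As Bs"
proof -
  have "hits r {s<..<t} g"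
    if "x \<in> inside s t" "g \<in> set As" "y \<in> fst g" "ov x y \<or> ov y x" for x y g
  proof -
    have "l y \<le> s" using that assms by (auto simp: left_groups_def)
    then have "r y \<in> {s<..<t}" using that by (auto simp: ov_def inside_def)
    then show ?thesis using that by (auto simp: hits_def)
  qed
  moreover have "hits l {s<..<t} g"
    if "x \<in> inside s t" "g \<in> set Bs" "y \<in> fst g" "ov x y \<or> ov y x" for x y g
  proof -
    have "t \<le> r y" using that assms by (auto simp: right_groups_def)
    then have "l y \<in> {s<..<t}" using that by (auto simp: ov_def inside_def)
    then show ?thesis using that by (auto simp: hits_def)
  qed
  ultimately have vis: "g \<in> set (filter (hits r {s<..<t}) As) \<union> set (filter (hits l {s<..<t}) Bs)"
    if "x \<in> inside s t" "g \<in> set As \<union> set Bs" "y \<in> fst g" "ov x y \<or> ov y x" for x y g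
    using that unfolding set_filter by blast
  obtain c p where
    "\<forall>x\<in>inside s t. c x < n \<and> l x \<le> p x \<and> p x \<le> r x"
    "\<forall>x\<in>inside s t. \<forall>y\<in>inside s t. ov x y \<longrightarrow> c x = c y \<longrightarrow> p x = p y"
    and c: "\<forall>x\<in>inside s t.
      \<forall>g\<in>set (filter (hits r {s<..<t}) As) \<union> set (filter (hits l {s<..<t}) Bs).
      \<forall>y\<in>fst g. ov x y \<or> ov y x \<longrightarrow> c x \<noteq> snd g"
    using assms(3) unfolding pillar_colourable_def by blast
  moreover have "\<forall>x\<in>inside s t. \<forall>g\<in>set As \<union> set Bs. \<forall>y\<in>fst g. ov x y \<or> ov y x \<longrightarrow> c x \<noteq> snd g"
    using c vis by blast
  ultimately show ?thesis unfolding pillar_colourable_def by blast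
qed

text \<open>A new pillar \<open>q\<close> with fresh colour \<open>g\<close> takes all intervals
  through it. The others lie on one side of \<open>q\<close>, and intervals on opposite sides do not
  overlap, so both colourings can be glued. Passing \<open>G\<close> as a group to both sides keeps
  \<open>g\<close> away from intervals overlapping \<open>G\<close>.\<close>

lemma pillar_colourable_split:
  assumes "s < q" "q < t" "g < n" "g \<notin> snd ` (set As \<union> set Bs)"
    and G: "G = {x\<in>inside s t. l x \<le> q \<and> q \<le> r x}"
    and left: "pillar_colourable n s q As ((G, g) # Bs)"
    and right: "pillar_colourable n q t (As @ [(G, g)]) Bs"
  shows "pillar_colourable n s t As Bs"
proof -
  obtain c1 p1 where c1:
    "\<forall>x\<in>inside s q. c1 x < n \<and> l x \<le> p1 x \<and> p1 x \<le> r x"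
    "\<forall>x\<in>inside s q. \<forall>y\<in>inside s q. ov x y \<longrightarrow> c1 x = c1 y \<longrightarrow> p1 x = p1 y"
    "\<forall>x\<in>inside s q. \<forall>h\<in>set As \<union> set ((G, g) # Bs). \<forall>y\<in>fst h.
      ov x y \<or> ov y x \<longrightarrow> c1 x \<noteq> snd h"
    using left unfolding pillar_colourable_def by (elim exE conjE) (rule that)
  obtain c2 p2 where c2:
    "\<forall>x\<in>inside q t. c2 x < n \<and> l x \<le> p2 x \<and> p2 x \<le> r x"
    "\<forall>x\<in>inside q t. \<forall>y\<in>inside q t. ov x y \<longrightarrow> c2 x = c2 y \<longrightarrow> p2 x = p2 y"
    "\<forall>x\<in>inside q t. \<forall>h\<in>set (As @ [(G, g)]) \<union> set Bs. \<forall>y\<in>fst h.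
      ov x y \<or> ov y x \<longrightarrow> c2 x \<noteq> snd h"
    using right unfolding pillar_colourable_def by (elim exE conjE) (rule that)
  have c1_G: "c1 x \<noteq> g" if "x \<in> inside s q" "y \<in> G" "ov x y \<or> ov y x" for x y
    using bspec[OF bspec[OF c1(3) that(1)], of "(G, g)"] that by auto
  have c2_G: "c2 x \<noteq> g" if "x \<in> inside q t" "y \<in> G" "ov x y \<or> ov y x" for x y
    using bspec[OF bspec[OF c2(3) that(1)], of "(G, g)"] that by auto
  define c where "c x = (if r x < q then c1 x else if q < l x then c2 x else g)" for x
  define p where "p x = (if r x < q then p1 x else if q < l x then p2 x else q)" for x
  have cases: "(x \<in> inside s q \<and> c x = c1 x \<and> p x = p1 x) \<or>
      (x \<in> inside q t \<and> c x = c2 x \<and> p x = p2 x) \<or> (x \<in> G \<and> c x = g \<and> p x = q)"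
    if "x \<in> inside s t" for x
    using that l_le_r[of x] \<open>s < q\<close> \<open>q < t\<close> unfolding G c_def p_def inside_def by auto
  have apart: False if "ov x y \<or> ov y x" "x \<in> inside s q" "y \<in> inside q t" for x y
    using that by (auto simp: ov_def inside_def)
  show ?thesis unfolding pillar_colourable_def
  proof (intro exI conjI ballI impI)
    fix x assume "x \<in> inside s t"
    from cases[OF this] show "c x < n" "l x \<le> p x" "p x \<le> r x"
      using c1(1) c2(1) \<open>g < n\<close> by (auto simp: G)
  next
    fix x y assume xy: "x \<in> inside s t" "y \<in> inside s t" "ov x y" "c x = c y"
    from cases[OF xy(1)] cases[OF xy(2)] show "p x = p y"
      using xy(3,4) c1(2) c2(2) c1_G c2_G apart by (elim disjE conjE) metis+
  next
    fix x h y assume x: "x \<in> inside s t" and h: "h \<in> set As \<union> set Bs" "y \<in> fst h" "ov x y \<or> ov y x"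
    from cases[OF x] show "c x \<noteq> snd h"
    proof (elim disjE conjE)
      assume "x \<in> inside s q" "c x = c1 x"
      moreover have "h \<in> set As \<union> set ((G, g) # Bs)" using h by auto
      ultimately show ?thesis using c1(3) h by metis
    next
      assume "x \<in> inside q t" "c x = c2 x"
      moreover have "h \<in> set (As @ [(G, g)]) \<union> set Bs" using h by auto
      ultimately show ?thesis using c2(3) h by metis
    next
      assume "c x = g"
      then show ?thesis using h(1) \<open>g \<notin> _\<close> by auto
    qed
  qed
qed

text \<open>Intervals inside the segment start after \<open>s\<close>, those of older left groups do
  not, so the new group goes to the end of the left list. Dually it goes to the front of the right
  list.\<close>

lemma left_groups_snoc:
  assumes "left_groups s As" "s \<le> q"
  shows "left_groups q (As @ [({x\<in>inside s t. l x \<le> q \<and> q \<le> r x}, g)])"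
  using assms by (fastforce simp: left_groups_def sorted_wrt_append inside_def)

lemma right_groups_Cons:
  assumes "right_groups t Bs" "q \<le> t"
  shows "right_groups q (({x\<in>inside s t. l x \<le> q \<and> q \<le> r x}, g) # Bs)"
  using assms by (fastforce simp: right_groups_def inside_def)

section \<open>Greedy placement of pillars and their number\<close>

text \<open>Each pillar stands at the first position where the half-open cell sees more than
  \<open>K\<close> groups; without its right end the cell sees at most \<open>K\<close>. Crowded
  half-open cells limit the number of pillars, light open cells serve the recursion. The process
  stops after \<open>n\<close> pillars.\<close>

lemma greedy_pillars:
  assumes "s < t"
  shows "\<exists>qs. successively (\<lambda>u v. u < v \<and> K < seen As Bs {u<..v}) (s # qs) \<and> last (s # qs) < t \<and>
    (length qs = n \<or>
     length qs < n \<and> successively (\<lambda>u v. u < v \<and> seen As Bs {u<..<v} \<le> K) (s # qs @ [t]))"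
  using assms
proof (induction n arbitrary: s)
  case 0
  then show ?case by (intro exI[of _ "[]"]) auto
next
  case (Suc n)
  show ?case
  proof (cases "seen As Bs {s<..<t} \<le> K")
    case True
    then show ?thesis using Suc.prems by (intro exI[of _ "[]"]) auto
  next
    case False
    define v where "v = (LEAST v. K < seen As Bs {s<..v})"
    have sub: "{s<..<b} = {s<..b - 1}" if "s < b" for b :: nat
      using that by auto
    \<comment> \<open>The position \<open>t - 1\<close> witnesses that the least crowded position
      exists and keeps it below \<open>t\<close>.\<close>
    have ex: "K < seen As Bs {s<..t - 1}"
      using False sub[OF \<open>s < t\<close>] by simp
    have v: "K < seen As Bs {s<..v}" "v \<le> t - 1"
      unfolding v_def using ex by (rule LeastI, rule Least_le)
    have "s < v"
    proof (rule ccontr)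
      assume "\<not> s < v"
      then have "{s<..v} = {}" by auto
      with v(1) show False by (simp add: seen_empty)
    qed
    have "\<not> K < seen As Bs {s<..v - 1}"
      using not_less_Least[of "v - 1" "\<lambda>v. K < seen As Bs {s<..v}"] \<open>s < v\<close> by (simp add: v_def)
    then have good: "seen As Bs {s<..<v} \<le> K" using sub[OF \<open>s < v\<close>] by simp
    have "v < t" using v(2) Suc.prems by simp
    from Suc.IH[OF this] obtain qs where
      "successively (\<lambda>u v. u < v \<and> K < seen As Bs {u<..v}) (v # qs)" "last (v # qs) < t"
      "length qs = n \<or> length qs < n \<and>
        successively (\<lambda>u v. u < v \<and> seen As Bs {u<..<v} \<le> K) (v # qs @ [t])" by blast
    then show ?thesis using v(1) \<open>s < v\<close> good by (intro exI[of _ "v # qs"]) auto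
  qed
qed

text \<open>Double counting in the matrices of groups against half-open cells: every cell sees at
  least \<open>K + 1\<close> groups, and \<open>diagonal_count\<close> bounds the nonempty entries
  for the left and for the right groups.\<close>

lemma crowded_cells_bound:
  assumes "left_groups s As" "right_groups t Bs" "last (s # qs) < t"
    and cells: "successively (\<lambda>u v. u < v \<and> K < seen As Bs {u<..v}) (s # qs)"
  shows "length qs * (K + 1) \<le> w * (length As + length Bs + 2 * length qs)"
proof -
  define q where "q = (!) (s # qs)"
  define n where "n = length qs"
  have "successively (<) (s # qs)" by (rule successively_mono[OF cells]) auto
  then have "sorted_wrt (<) (s # qs)" by (simp add: successively_conv_sorted_wrt)
  from sorted_wrt_nth_less[OF this] have q_less: "q i < q j" if "i < j" "j \<le> n" for i j
    using that by (simp add: q_def n_def)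
  have q_le: "q i \<le> q j" if "i \<le> j" "j \<le> n" for i j
    using q_less[of i j] that by (cases "i = j") auto
  have "last (s # qs) = q n" unfolding q_def n_def by (subst last_conv_nth) auto
  then have q_t: "q j < t" if "j \<le> n" for j using assms(3) q_le[OF that] by simp
  have q_s: "s \<le> q j" if "j \<le> n" for j using q_le[of 0 j] that by (simp add: q_def)
  have crowded: "K + 1 \<le> seen As Bs {q j<..q (Suc j)}" if "j < n" for j
    using cells that unfolding successively_conv_nth q_def n_def by fastforce
  have card_filter: "length (filter (hits e T) Cs) =
      card {i. i < length Cs \<and> {x\<in>fst (Cs ! i). e x \<in> T} \<noteq> {}}" for e T Cs
    unfolding length_filter_conv_card hits_def by (rule arg_cong[of _ _ card]) auto
  \<comment> \<open>Groups order the left ends and cells the right ends; the intervals meet because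
    left ends are at most \<open>s\<close> and right ends lie beyond it.\<close>
  have L: "(\<Sum>j<n. length (filter (hits r {q j<..q (Suc j)}) As)) \<le> w * (length As + n)"
    unfolding card_filter
  proof (rule diagonal_count)
    show "{x\<in>fst (As ! i). r x \<in> {q j<..q (Suc j)}} \<subseteq> U" if "i < length As" for i j
      using assms(1) nth_mem[OF that] by (fastforce simp: left_groups_def)
    fix i i' j j' x y
    assume *: "i < i'" "i' < length As" "j < j'" "j' < n"
      and x: "x \<in> {x\<in>fst (As ! i). r x \<in> {q j<..q (Suc j)}}"
      and y: "y \<in> {x\<in>fst (As ! i'). r x \<in> {q j'<..q (Suc j')}}"
    have "l x < l y"
      using assms(1) * x y by (auto simp: left_groups_def dest: sorted_wrt_nth_less)
    moreover have "r x < r y" using x y q_le[of "Suc j" j'] * by auto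
    moreover have "l y \<le> s"
      using assms(1) nth_mem[OF *(2)] y by (fastforce simp: left_groups_def)
    then have "l y \<le> r x" using x q_s[of j] * by auto
    ultimately show "ov x y \<or> ov y x" by (simp add: ov_def)
  qed
  \<comment> \<open>Mirror image: cells order the left ends, which lie before \<open>t\<close>, and
    groups the right ends, which do not.\<close>
  have R: "(\<Sum>j<n. length (filter (hits l {q j<..q (Suc j)}) Bs)) \<le> w * (length Bs + n)"
    unfolding card_filter
  proof (rule diagonal_count)
    show "{x\<in>fst (Bs ! i). l x \<in> {q j<..q (Suc j)}} \<subseteq> U" if "i < length Bs" for i j
      using assms(2) nth_mem[OF that] by (fastforce simp: right_groups_def)
    fix i i' j j' x y
    assume *: "i < i'" "i' < length Bs" "j < j'" "j' < n"
      and x: "x \<in> {x\<in>fst (Bs ! i). l x \<in> {q j<..q (Suc j)}}"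
      and y: "y \<in> {x\<in>fst (Bs ! i'). l x \<in> {q j'<..q (Suc j')}}"
    have "r x < r y"
      using assms(2) * x y by (auto simp: right_groups_def dest: sorted_wrt_nth_less)
    moreover have "l x < l y" using x y q_le[of "Suc j" j'] * by auto
    moreover have "t \<le> r x"
      using assms(2) nth_mem[of i Bs] x * by (fastforce simp: right_groups_def)
    then have "l y \<le> r x" using y q_t[of "Suc j'"] * by auto
    ultimately show "ov x y \<or> ov y x" by (simp add: ov_def)
  qed
  have "n * (K + 1) = (\<Sum>j<n. K + 1)" by simp
  also have "\<dots> \<le> (\<Sum>j<n. seen As Bs {q j<..q (Suc j)})"
    using crowded by (intro sum_mono) auto
  also have "\<dots> \<le> w * (length As + n) + w * (length Bs + n)"
    unfolding seen_def sum.distrib using L R by (rule add_mono)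
  finally show ?thesis by (simp add: n_def algebra_simps)
qed

section \<open>Recursion over segments\<close>

text \<open>The pillars \<open>qs\<close> are split off from left to right, and \<open>Ns\<close>
  collects the groups of those already placed. An open cell sees at most \<open>k - m\<close> old
  groups and at most \<open>m\<close> new ones, so \<open>IH\<close> applies to it. The condition
  for \<open>qs = []\<close> ensures that the last cell is shorter than the original
  segment.\<close>

lemma pillar_colourable_pillars:
  assumes IH: "\<And>s t As Bs. t - s < N \<Longrightarrow> left_groups s As \<Longrightarrow> right_groups t Bs \<Longrightarrow>
      length As + length Bs \<le> k \<Longrightarrow> pillar_colourable (k + m) s t As Bs"
    and "m \<le> k" "length As + length Bs \<le> k" "right_groups t Bs"
  shows "successively (\<lambda>u v. u < v \<and> seen As Bs {u<..<v} \<le> k - m) (s # qs @ [t]) \<Longrightarrow>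
    left_groups s (As @ Ns) \<Longrightarrow> length Ns + length qs \<le> m \<Longrightarrow>
    t - s \<le> N \<Longrightarrow> (qs = [] \<Longrightarrow> t - s < N) \<Longrightarrow> pillar_colourable (k + m) s t (As @ Ns) Bs"
proof (induction qs arbitrary: s Ns)
  case Nil
  have groups: "left_groups s (filter P (As @ Ns))" "right_groups t (filter P Bs)" for P
    using Nil.prems(2) assms(4) by (auto simp: left_groups_def right_groups_def
        sorted_wrt_append intro: sorted_wrt_filter)
  have "length (filter (hits r {s<..<t}) (As @ Ns)) + length (filter (hits l {s<..<t}) Bs)
      \<le> seen As Bs {s<..<t} + length Ns"
    by (simp add: seen_def)
  also have "\<dots> \<le> k" using Nil.prems(1,3) \<open>m \<le> k\<close> by auto
  finally have "pillar_colourable (k + m) s t (filter (hits r {s<..<t}) (As @ Ns))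
      (filter (hits l {s<..<t}) Bs)"
    using Nil.prems(5) by (intro IH groups) auto
  then show ?case by (rule pillar_colourable_visible[OF Nil.prems(2) assms(4)])
next
  case (Cons q qs)
  have "successively (<) (s # (q # qs) @ [t])"
    by (rule successively_mono[OF Cons.prems(1)]) auto
  then have "sorted_wrt (<) (s # (q # qs) @ [t])" by (subst successively_conv_sorted_wrt[symmetric]) auto
  then have "s < q" "q < t" by auto
  \<comment> \<open>At most \<open>k\<close> old and fewer than \<open>m\<close> new groups exist so
    far, which leaves a fresh colour.\<close>
  have "card (snd ` set (As @ Ns @ Bs)) \<le> length (As @ Ns @ Bs)"
    by (meson card_image_le card_length finite_set le_trans)
  also have "\<dots> < k + m" using Cons.prems(3) assms(3) by simp
  finally have "\<not> {..<k + m} \<subseteq> snd ` set (As @ Ns @ Bs)"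
    using card_mono[of "snd ` set (As @ Ns @ Bs)" "{..<k + m}"] by auto
  then obtain g where g: "g < k + m" "g \<notin> snd ` set (As @ Ns @ Bs)" by blast
  define G where "G = {x\<in>inside s t. l x \<le> q \<and> q \<le> r x}"
  have rg: "right_groups q ((G, g) # Bs)"
    unfolding G_def using assms(4) \<open>q < t\<close> by (intro right_groups_Cons) auto
  have lg: "left_groups q ((As @ Ns) @ [(G, g)])"
    unfolding G_def using Cons.prems(2) \<open>s < q\<close> by (intro left_groups_snoc) auto
  have groups: "left_groups s (filter P (As @ Ns))" "right_groups q (filter P ((G, g) # Bs))" for P
    using Cons.prems(2) rg
    by (auto simp: left_groups_def right_groups_def sorted_wrt_append intro: sorted_wrt_filter)
  \<comment> \<open>The additional 1 is the group of \<open>q\<close> itself, which borders this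
    cell on the right.\<close>
  have "length (filter (hits r {s<..<q}) (As @ Ns)) + length (filter (hits l {s<..<q}) ((G, g) # Bs))
      \<le> seen As Bs {s<..<q} + length Ns + 1"
    by (simp add: seen_def le_SucI)
  also have "\<dots> \<le> k" using Cons.prems(1,3) \<open>m \<le> k\<close> by auto
  finally have "pillar_colourable (k + m) s q (filter (hits r {s<..<q}) (As @ Ns))
      (filter (hits l {s<..<q}) ((G, g) # Bs))"
    using Cons.prems(4) \<open>s < q\<close> \<open>q < t\<close> by (intro IH groups) auto
  then have left: "pillar_colourable (k + m) s q (As @ Ns) ((G, g) # Bs)"
    by (rule pillar_colourable_visible[OF Cons.prems(2) rg])
  have "pillar_colourable (k + m) q t (As @ Ns @ [(G, g)]) Bs"
    by (rule Cons.IH) (use Cons.prems lg \<open>s < q\<close> \<open>q < t\<close> in auto)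
  then have "pillar_colourable (k + m) q t ((As @ Ns) @ [(G, g)]) Bs" by simp
  from pillar_colourable_split[OF \<open>s < q\<close> \<open>q < t\<close> g(1) _ G_def left this] g(2)
  show ?case by auto
qed

text \<open>The constants reproduce themselves: cells seeing at most \<open>6 * w\<close> old groups
  and at most \<open>2 * w\<close> new pillars again give \<open>8 * w\<close> groups per cell, and
  \<open>2 * w\<close> further colours cover the new pillars.\<close>

lemma pillar_colourable_segment:
  assumes "left_groups s As" "right_groups t Bs" "length As + length Bs \<le> 8 * w"
  shows "pillar_colourable (8 * w + 2 * w) s t As Bs"
  using assms
proof (induction "t - s" arbitrary: s t As Bs rule: less_induct)
  case less
  show ?case
  proof (cases "Suc s < t")
    case False
    then have "inside s t = {}" using l_le_r by (fastforce simp: inside_def)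
    then show ?thesis by (simp add: pillar_colourable_def)
  next
    case True
    then have "s < t" by simp
    obtain qs where cells: "successively (\<lambda>u v. u < v \<and> 6 * w < seen As Bs {u<..v}) (s # qs)"
      and "last (s # qs) < t"
      and qs: "length qs = 2 * w + 1 \<or> length qs < 2 * w + 1 \<and>
        successively (\<lambda>u v. u < v \<and> seen As Bs {u<..<v} \<le> 6 * w) (s # qs @ [t])"
      using greedy_pillars[OF \<open>s < t\<close>, where K = "6 * w" and n = "2 * w + 1"] by blast
    \<comment> \<open>Otherwise counting would give
      \<open>(2 * w + 1) * (6 * w + 1) \<le> w * (12 * w + 2)\<close>, that is,
      \<open>12 * w * w + 8 * w + 1 \<le> 12 * w * w + 2 * w\<close>.\<close>
    have "length qs \<noteq> 2 * w + 1"
    proof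
      assume len: "length qs = 2 * w + 1"
      have "length qs * (6 * w + 1) \<le> w * (length As + length Bs + 2 * length qs)"
        using crowded_cells_bound[OF less.prems(1,2) \<open>last (s # qs) < t\<close> cells] .
      also have "\<dots> \<le> w * (8 * w + 2 * length qs)" using less.prems(3) by simp
      finally show False unfolding len by (simp add: algebra_simps)
    qed
    with qs have qs: "length qs \<le> 2 * w"
      "successively (\<lambda>u v. u < v \<and> seen As Bs {u<..<v} \<le> 6 * w) (s # qs @ [t])" by auto
    \<comment> \<open>If the greedy process places no pillar, one is put at \<open>Suc s\<close>, so
      that every cell is shorter than the segment.\<close>
    define ps where "ps = (if qs = [] then [Suc s] else qs)"
    have "length ps \<le> 2 * w" "ps \<noteq> []" using qs w_pos by (auto simp: ps_def)
    moreover have "successively (\<lambda>u v. u < v \<and> seen As Bs {u<..<v} \<le> 8 * w - 2 * w) (s # ps @ [t])"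
    proof (cases "qs = []")
      case True
      have "seen As Bs {s<..<Suc s} \<le> seen As Bs {s<..<t}" "seen As Bs {Suc s<..<t} \<le> seen As Bs {s<..<t}"
        by (rule seen_mono; auto)+
      then show ?thesis using qs True \<open>Suc s < t\<close> by (simp add: ps_def)
    next
      case False
      then show ?thesis using qs by (simp add: ps_def)
    qed
    ultimately have "pillar_colourable (8 * w + 2 * w) s t (As @ []) Bs"
      using less.prems
      by (intro pillar_colourable_pillars[where N = "t - s" and qs = ps] less.hyps) auto
    then show ?thesis by simp
  qed
qed

text \<open>Pairs of a pillar colour and a colour among the intervals at that pillar are encoded as
  one number. Overlapping intervals with equal pillar colours share their pillar, where
  \<open>stabbed_colouring\<close> tells them apart.\<close>

lemma overlap_colouring:
  "\<exists>c. (\<forall>x\<in>U. c x < 10 * w * w) \<and> (\<forall>x\<in>U. \<forall>y\<in>U. ov x y \<longrightarrow> c x \<noteq> (c y :: nat))"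
proof -
  define t where "t = Suc (Max (r ` U))"
  have U: "inside 0 t = U"
    using l_pos finite_U by (auto simp: inside_def t_def less_Suc_eq_le)
  have "pillar_colourable (8 * w + 2 * w) 0 t [] []"
    by (rule pillar_colourable_segment) (auto simp: left_groups_def right_groups_def)
  then obtain c p where c: "\<forall>x\<in>U. c x < 10 * w \<and> l x \<le> p x \<and> p x \<le> r x"
    "\<forall>x\<in>U. \<forall>y\<in>U. ov x y \<longrightarrow> c x = c y \<longrightarrow> p x = p y"
    unfolding pillar_colourable_def U by auto
  obtain h where h: "\<And>q. (\<forall>x\<in>U. l x \<le> q \<longrightarrow> q \<le> r x \<longrightarrow> h q x < w) \<and>
    (\<forall>x\<in>U. \<forall>y\<in>U. l x \<le> q \<longrightarrow> q \<le> r x \<longrightarrow> l y \<le> q \<longrightarrow> q \<le> r y \<longrightarrow> ov x y \<longrightarrow> h q x \<noteq> (h q y :: nat))"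
    using stabbed_colouring by metis
  define d where "d x = c x * w + h (p x) x" for x
  have hw: "h (p x) x < w" if "x \<in> U" for x using h[of "p x"] c(1) that by blast
  have d: "d x div w = c x" "d x mod w = h (p x) x" if "x \<in> U" for x
    using hw[OF that] by (auto simp: d_def)
  have "d x < 10 * w * w" if "x \<in> U" for x
    using d(1)[OF that] c(1) that w_pos by (metis div_less_iff_less_mult)
  moreover have "d x \<noteq> d y" if "x \<in> U" "y \<in> U" "ov x y" for x y
  proof
    assume "d x = d y"
    then have "c x = c y" "h (p x) x = h (p y) y" using d that by metis+
    then show False using c h[of "p x"] that by metis
  qed
  ultimately show ?thesis by blast
qed

end

section \<open>Overlap-free families\<close>

text \<open>Induction by removing a shortest interval \<open>v\<close>. Its neighbours contain it
  and hence are nested in each other; \<open>between\<close> with \<open>v\<close> innermost makes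
  them adjacent. So \<open>v\<close> and its neighbours form a clique, and a colour below
  \<open>w\<close> is left for \<open>v\<close>.\<close>

lemma laminar_colouring:
  fixes l r :: "'a \<Rightarrow> nat"
  assumes "finite W"
    and sym: "\<And>u v. adj u v \<Longrightarrow> adj v u"
    and le: "\<And>u. u \<in> W \<Longrightarrow> l u \<le> r u"
    and nested: "\<And>u v. u \<in> W \<Longrightarrow> v \<in> W \<Longrightarrow> l u \<le> r v \<Longrightarrow> l v \<le> r u \<Longrightarrow>
      (l u \<le> l v \<and> r v \<le> r u) \<or> (l v \<le> l u \<and> r u \<le> r v)"
    and meet: "\<And>u v. u \<in> W \<Longrightarrow> v \<in> W \<Longrightarrow> adj u v \<Longrightarrow> l u \<le> r v"
    and between: "\<And>u v x. u \<in> W \<Longrightarrow> v \<in> W \<Longrightarrow> x \<in> W \<Longrightarrow> u \<noteq> v \<Longrightarrow>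
      l u \<le> l v \<Longrightarrow> r v \<le> r u \<Longrightarrow> l v \<le> l x \<Longrightarrow> r x \<le> r v \<Longrightarrow> adj u x \<Longrightarrow> adj u v"
    and cliques: "\<And>K. K \<subseteq> W \<Longrightarrow> (\<And>u v. u \<in> K \<Longrightarrow> v \<in> K \<Longrightarrow> u \<noteq> v \<Longrightarrow> adj u v) \<Longrightarrow> card K \<le> w"
  shows "\<exists>h. (\<forall>u\<in>W. h u < w) \<and> (\<forall>u\<in>W. \<forall>v\<in>W. u \<noteq> v \<longrightarrow> adj u v \<longrightarrow> h u \<noteq> (h v :: nat))"
proof -
  have "\<exists>h. (\<forall>u\<in>S. h u < w) \<and> (\<forall>u\<in>S. \<forall>v\<in>S. u \<noteq> v \<longrightarrow> adj u v \<longrightarrow> h u \<noteq> (h v :: nat))"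
    if "S \<subseteq> W" for S
    using finite_subset[OF that \<open>finite W\<close>] that
  proof (induction S rule: finite_psubset_induct)
    case (psubset S)
    show ?case
    proof (cases "S = {}")
      case False
      obtain v where v: "v \<in> S" "\<And>u. u \<in> S \<Longrightarrow> r v - l v \<le> r u - l u"
        using ex_min_if_finite[of "(\<lambda>u. r u - l u) ` S"] False psubset.hyps
        by (metis (mono_tags, lifting) arg_min_if_finite(1) arg_min_least)
      define N where "N = {u\<in>S. u \<noteq> v \<and> adj u v}"
      have S: "S \<subseteq> W" by fact
      \<comment> \<open>If instead \<open>u\<close> lies inside \<open>v\<close>, minimality of the
        length of \<open>v\<close> forces equal ends.\<close>
      have around: "l u \<le> l v \<and> r v \<le> r u" if "u \<in> N" for u
      proof -
        have u: "u \<in> W" "v \<in> W" "r v - l v \<le> r u - l u" "adj u v" "adj v u"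
          using that v S sym by (auto simp: N_def)
        show ?thesis
          using nested[OF u(1,2) meet[OF u(1,2,4)] meet[OF u(2,1,5)]] le[OF u(1)] le[OF u(2)] u(3)
          by linarith
      qed
      have "adj x y" if "x \<in> insert v N" "y \<in> insert v N" "x \<noteq> y" for x y
      proof (cases "x = v \<or> y = v")
        case True
        then show ?thesis using that sym by (auto simp: N_def)
      next
        case F: False
        then have N: "x \<in> N" "y \<in> N" using that by auto
        then have W: "x \<in> W" "y \<in> W" "v \<in> W" "adj x v" "adj y v" using S v by (auto simp: N_def)
        have "l x \<le> r y" "l y \<le> r x"
          using around[OF N(1)] around[OF N(2)] le[OF W(3)] by linarith+
        from nested[OF W(1,2) this] show ?thesis
          using between[OF W(1,2,3)] between[OF W(2,1,3)] W(4,5) around[OF N(1)] around[OF N(2)]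
            \<open>x \<noteq> y\<close> sym by blast
      qed
      moreover have "insert v N \<subseteq> W" using S v by (auto simp: N_def)
      ultimately have "card (insert v N) \<le> w" by (intro cliques)
      moreover have "finite N" "v \<notin> N" using psubset.hyps by (auto simp: N_def)
      ultimately have "card N < w" by simp
      have "S - {v} \<subset> S" "S - {v} \<subseteq> W" using v S by auto
      then obtain h where h: "\<forall>u\<in>S - {v}. h u < w"
        "\<forall>u\<in>S - {v}. \<forall>x\<in>S - {v}. u \<noteq> x \<longrightarrow> adj u x \<longrightarrow> h u \<noteq> (h x :: nat)"
        using psubset.IH by metis
      have "\<not> {..<w} \<subseteq> h ` N"
        using card_mono[of "h ` N" "{..<w}"] card_image_le[of N h] \<open>finite N\<close> \<open>card N < w\<close> by auto
      then obtain a where a: "a < w" "a \<notin> h ` N" by blast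
      show ?thesis
      proof (intro exI[of _ "h(v := a)"] conjI ballI impI)
        fix u assume "u \<in> S"
        then show "(h(v := a)) u < w" using h a by auto
      next
        fix u x assume "u \<in> S" "x \<in> S" "u \<noteq> x" "adj u x"
        moreover have "adj x u" using sym[OF \<open>adj u x\<close>] .
        ultimately show "(h(v := a)) u \<noteq> (h(v := a)) x"
          using h(2) a(2) by (auto simp: N_def)
      qed
    qed simp
  qed
  then show ?thesis by blast
qed

section \<open>Polygons inscribed in the unit circle\<close>

text \<open>Twice the signed area of the triangle \<open>a\<close>, \<open>b\<close>,
  \<open>z\<close>, positive for counterclockwise order.\<close>

definition orient :: "complex \<Rightarrow> complex \<Rightarrow> complex \<Rightarrow> real" where
  "orient a b z = Im (cnj (b - a) * (z - a))"

lemma orient_cyclic: "orient a b c = orient b c a"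
  by (simp add: orient_def algebra_simps)

lemma orient_swap: "orient a c b = - orient a b c"
  by (simp add: orient_def algebra_simps)

text \<open>The product form shows the sign: for increasing arguments within one period all three
  half differences lie between 0 and \<open>pi\<close>.\<close>

lemma orient_cis:
  "orient (cis x) (cis y) (cis z) = 4 * sin ((y - x) / 2) * sin ((z - y) / 2) * sin ((z - x) / 2)"
proof -
  define u v where "u = (y - x) / 2" and "v = (z - y) / 2"
  have "orient (cis x) (cis y) (cis z) = sin (y - x) + sin (z - y) - sin (z - x)"
    by (simp add: orient_def sin_diff algebra_simps)
  also have "\<dots> = sin (2 * u) + sin (2 * v) - sin (2 * (u + v))"
  proof -
    have "2 * u = y - x" "2 * v = z - y" "2 * (u + v) = z - x"
      by (auto simp: u_def v_def field_simps)
    then show ?thesis by simp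
  qed
  also have "\<dots> = 4 * sin u * sin v * sin (u + v)"
    using sin_cos_squared_add[of u] sin_cos_squared_add[of v]
    unfolding sin_double sin_add cos_add by algebra
  also have "u + v = (z - x) / 2" by (simp add: u_def v_def field_simps)
  finally show ?thesis by (simp add: u_def v_def)
qed

lemma orient_pos:
  assumes "cmod a = 1" "cmod b = 1" "cmod c = 1" "Arg a < Arg b" "Arg b < Arg c"
  shows "orient a b c > 0"
proof -
  have *: "z = cis (Arg z)" if "cmod z = 1" for z
    using that rcis_cmod_Arg[of z] by (simp add: rcis_def)
  have "- pi < Arg a" "Arg c \<le> pi" using Arg_bounded by blast+
  then have "0 < sin ((Arg b - Arg a) / 2)" "0 < sin ((Arg c - Arg b) / 2)"
    "0 < sin ((Arg c - Arg a) / 2)"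
    using assms by (intro sin_gt_zero; simp)+
  then show ?thesis
    using orient_cis[of "Arg a" "Arg b" "Arg c"] assms by (simp flip: *)
qed

text \<open>The intersection point is read off the affine dependence of four points in the plane, whose
  coefficients are orientations.\<close>

lemma chords_cross:
  assumes "cmod a = 1" "cmod b = 1" "cmod c = 1" "cmod d = 1"
    and "Arg a < Arg b" "Arg b < Arg c" "Arg c < Arg d"
  shows "closed_segment a c \<inter> closed_segment b d \<noteq> {}"
proof -
  \<comment> \<open>Twice the area of the quadrilateral, cut along either diagonal. It is the
    coefficient sum on both sides of the dependence, so division by it yields convex
    combinations.\<close>
  define S where "S = orient b c d + orient a b d"
  have S': "S = orient a c d + orient a b c"
    by (simp add: S_def orient_def algebra_simps)
  have pos: "orient b c d > 0" "orient a b d > 0" "orient a c d > 0" "orient a b c > 0"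
    using assms by (intro orient_pos; simp)+
  then have "S > 0" by (simp add: S_def)
  define z where "z = (orient b c d / S) *\<^sub>R a + (orient a b d / S) *\<^sub>R c"
  have "orient b c d *\<^sub>R a + orient a b d *\<^sub>R c = orient a c d *\<^sub>R b + orient a b c *\<^sub>R d"
    by (simp add: complex_eq_iff orient_def algebra_simps)
  then have "(1 / S) *\<^sub>R (orient b c d *\<^sub>R a + orient a b d *\<^sub>R c) =
      (1 / S) *\<^sub>R (orient a c d *\<^sub>R b + orient a b c *\<^sub>R d)" by (rule arg_cong)
  then have z: "z = (orient a c d / S) *\<^sub>R b + (orient a b c / S) *\<^sub>R d"
    by (simp add: z_def scaleR_add_right)
  have "z \<in> convex hull {a, c}"
    unfolding convex_hull_2 z_def
  proof (intro CollectI exI conjI, rule refl)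
    show "orient b c d / S + orient a b d / S = 1"
      using \<open>S > 0\<close> by (simp add: S_def flip: add_divide_distrib)
  qed (use pos \<open>S > 0\<close> in auto)
  moreover have "z \<in> convex hull {b, d}"
    unfolding convex_hull_2 z
  proof (intro CollectI exI conjI, rule refl)
    show "orient a c d / S + orient a b c / S = 1"
      using \<open>S > 0\<close> by (simp add: S' flip: add_divide_distrib)
  qed (use pos \<open>S > 0\<close> in auto)
  ultimately show ?thesis by (auto simp: segment_convex_hull)
qed

text \<open>The line through \<open>a\<close> and \<open>b\<close> separates: points of
  \<open>A\<close> lie strictly on its positive side, points of \<open>B\<close> on it or on the
  other side, and half-planes are convex.\<close>

lemma separated_hulls:
  assumes a: "cmod a = 1" and b: "cmod b = 1" and ab: "Arg a < Arg b"
    and A: "\<And>z. z \<in> A \<Longrightarrow> cmod z = 1 \<and> (Arg z < Arg a \<or> Arg b < Arg z)"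
    and B: "\<And>z. z \<in> B \<Longrightarrow> cmod z = 1 \<and> (z = a \<or> z = b \<or> (Arg a < Arg z \<and> Arg z < Arg b))"
  shows "convex hull A \<inter> convex hull B = {}"
proof -
  have affine: "orient a b z = inner (\<i> * (b - a)) z + orient a b 0" for z
    by (simp add: orient_def inner_complex_def algebra_simps)
  have half: "{z. orient a b z > 0} = {z. inner (\<i> * (b - a)) z > - orient a b 0}"
    "{z. orient a b z \<le> 0} = {z. inner (\<i> * (b - a)) z \<le> - orient a b 0}"
    by (subst affine; auto)+
  have "orient a b z > 0" if "z \<in> A" for z
    using A[OF that] orient_pos[OF a b, of z] orient_pos[OF _ a b, of z] ab
    by (auto simp: orient_cyclic[of z a b])
  then have "convex hull A \<subseteq> {z. orient a b z > 0}"
    by (intro hull_minimal) (blast, simp only: half convex_halfspace_gt)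
  moreover have "orient a b z \<le> 0" if z: "z \<in> B" for z
  proof -
    consider "z = a" | "z = b" | "cmod z = 1" "Arg a < Arg z" "Arg z < Arg b" using B[OF z] by auto
    then show ?thesis
    proof cases
      case 3
      then show ?thesis using orient_pos[OF a _ b, of z] orient_swap[of a z b] by simp
    qed (auto simp: orient_def algebra_simps)
  qed
  then have "convex hull B \<subseteq> {z. orient a b z \<le> 0}"
    by (intro hull_minimal) (blast, simp only: half convex_halfspace_le)
  ultimately show ?thesis by fastforce
qed

section \<open>From inscribed polygons to intervals\<close>

lemma inscribed_polygon_corners:
  assumes "inscribed_polygon P"
  shows "finite {x. x extreme_point_of P}"
    and "convex hull {x. x extreme_point_of P} = P"
    and "\<exists>x y. x extreme_point_of P \<and> y extreme_point_of P \<and> x \<noteq> y"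
    and "\<And>x. x extreme_point_of P \<Longrightarrow> cmod x = 1"
proof -
  have P: "polytope P" "interior P \<noteq> {}" "{x. x extreme_point_of P} \<subseteq> sphere 0 1"
    using assms by (auto simp: inscribed_polygon_def)
  then obtain S where "finite S" "P = convex hull S" by (auto simp: polytope_def)
  then show "finite {x. x extreme_point_of P}"
    using finite_subset extreme_points_of_convex_hull by metis
  show hull: "convex hull {x. x extreme_point_of P} = P"
    using Krein_Milman_Minkowski[of P] P(1) polytope_imp_compact polytope_imp_convex by metis
  show "cmod x = 1" if "x extreme_point_of P" for x using P(3) that by auto
  show "\<exists>x y. x extreme_point_of P \<and> y extreme_point_of P \<and> x \<noteq> y"
  proof (rule ccontr)
    assume "\<not> ?thesis"
    then obtain x where "{x. x extreme_point_of P} \<subseteq> {x}" by blast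
    from hull_mono[OF this, of convex] have "P \<subseteq> {x}" unfolding hull by simp
    then have "interior P \<subseteq> {}" using interior_mono[of P "{x}"] by simp
    with P(2) show False by blast
  qed
qed

lemma inscribed_polygon_intervals:
  fixes P :: "'a \<Rightarrow> complex set"
  assumes "finite V" and poly: "\<And>v. v \<in> V \<Longrightarrow> inscribed_polygon (P v)"
  obtains l r :: "'a \<Rightarrow> nat" where
    "\<And>u. u \<in> V \<Longrightarrow> 0 < l u \<and> l u \<le> r u"
    and "\<And>u v. u \<in> V \<Longrightarrow> v \<in> V \<Longrightarrow> l u < l v \<and> l v \<le> r u \<and> r u < r v \<Longrightarrow> P u \<inter> P v \<noteq> {}"
    and "\<And>u v. u \<in> V \<Longrightarrow> v \<in> V \<Longrightarrow> r u < l v \<Longrightarrow> P u \<inter> P v = {}"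
    and "\<And>u v x. u \<in> V \<Longrightarrow> v \<in> V \<Longrightarrow> x \<in> V \<Longrightarrow> l u \<le> l v \<Longrightarrow> r v \<le> r u \<Longrightarrow>
      l v \<le> l x \<Longrightarrow> r x \<le> r v \<Longrightarrow> P u \<inter> P x \<noteq> {} \<Longrightarrow> P u \<inter> P v \<noteq> {}"
proof -
  define X where "X v = {x. x extreme_point_of P v}" for v
  define C where "C = (\<Union>v\<in>V. X v)"
  \<comment> \<open>Equal ranks mean equal corners, as the argument determines a point of the
    circle. \<open>Suc\<close> makes the positions positive.\<close>
  define rk where "rk z = Suc (card {y\<in>C. Arg y < Arg z})" for z
  define l where "l v = Min (rk ` X v)" for v
  define r where "r v = Max (rk ` X v)" for v
  note corners = inscribed_polygon_corners[OF poly, folded X_def]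
  have fin: "finite (X v)" if "v \<in> V" for v using corners(1)[OF that] .
  have ne: "X v \<noteq> {}" if "v \<in> V" for v using corners(3)[OF that] by (auto simp: X_def)
  have "finite C" using fin \<open>finite V\<close> by (auto simp: C_def)
  have XC: "x \<in> C" if "v \<in> V" "x \<in> X v" for v x using that by (auto simp: C_def)
  have norm: "cmod x = 1" if "x \<in> C" for x using that corners(4) by (auto simp: C_def X_def)
  have Arg_less: "rk x < rk y" if "x \<in> C" "Arg x < Arg y" for x y
    unfolding rk_def using that \<open>finite C\<close> by (intro Suc_mono psubset_card_mono) force+
  have rk_less: "Arg x < Arg y" if "rk x < rk y" "x \<in> C" "y \<in> C" for x y
  proof -
    have "Arg x \<noteq> Arg y" using that(1) by (auto simp: rk_def)
    then show ?thesis using that Arg_less[of y x] by linarith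
  qed
  have rk_inj: "x = y" if "rk x = rk y" "x \<in> C" "y \<in> C" for x y
  proof -
    have "Arg x = Arg y" using that Arg_less[of x y] Arg_less[of y x] by linarith
    then show ?thesis using norm that rcis_cmod_Arg by metis
  qed
  have l: "\<exists>a\<in>X v. rk a = l v" if "v \<in> V" for v
  proof -
    have "l v \<in> rk ` X v" unfolding l_def using fin[OF that] ne[OF that] by (intro Min_in) auto
    then show ?thesis by auto
  qed
  have r: "\<exists>b\<in>X v. rk b = r v" if "v \<in> V" for v
  proof -
    have "r v \<in> rk ` X v" unfolding r_def using fin[OF that] ne[OF that] by (intro Max_in) auto
    then show ?thesis by auto
  qed
  have between: "l v \<le> rk x" "rk x \<le> r v" if "v \<in> V" "x \<in> X v" for v x
    unfolding l_def r_def using fin that by auto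
  have l_less_r: "l v < r v" if v: "v \<in> V" for v
  proof -
    obtain x y where "x \<in> X v" "y \<in> X v" "x \<noteq> y" using corners(3)[OF v] by (auto simp: X_def)
    then have "rk x \<noteq> rk y" using rk_inj XC v by blast
    then show ?thesis
      using between[OF v \<open>x \<in> X v\<close>] between[OF v \<open>y \<in> X v\<close>] by linarith
  qed
  have sub: "X v \<subseteq> P v" for v by (auto simp: X_def extreme_point_of_def)
  have seg: "closed_segment x y \<subseteq> P v" if "v \<in> V" "x \<in> X v" "y \<in> X v" for v x y
    using corners(2)[OF that(1)] that(2,3)
    by (metis closed_segment_subset convex_convex_hull hull_subset subsetD)
  \<comment> \<open>An equality of ranks yields a common corner; otherwise the two chords alternate
    and cross.\<close>
  have cross: "P u \<inter> P v \<noteq> {}"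
    if uv: "u \<in> V" "v \<in> V" "x \<in> X u" "y \<in> X u" "x' \<in> X v" "y' \<in> X v"
      and rks: "rk x \<le> rk x'" "rk x' \<le> rk y" "rk y \<le> rk y'" for u v x y x' y'
  proof (cases "rk x = rk x' \<or> rk x' = rk y \<or> rk y = rk y'")
    case True
    then have "x = x' \<or> x' = y \<or> y = y'" using rk_inj XC uv by metis
    then show ?thesis using uv sub by blast
  next
    case False
    then have "closed_segment x y \<inter> closed_segment x' y' \<noteq> {}"
      using rks uv XC norm by (intro chords_cross rk_less) (auto simp: le_less)
    then show ?thesis using seg uv by blast
  qed
  \<comment> \<open>The separating line passes through the first and the last corner of
    \<open>v\<close>.\<close>
  have apart: "P u \<inter> P x = {}"
    if V: "u \<in> V" "v \<in> V" "x \<in> V" and out: "\<And>z. z \<in> X u \<Longrightarrow> rk z < l v \<or> r v < rk z"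
      and sub: "l v \<le> l x" "r x \<le> r v" for u v x
  proof -
    obtain a b where ab: "a \<in> X v" "rk a = l v" "b \<in> X v" "rk b = r v" using l r V by blast
    then have C: "a \<in> C" "b \<in> C" using XC V by auto
    have "convex hull X u \<inter> convex hull X x = {}"
    proof (rule separated_hulls[of a b])
      show "Arg a < Arg b" using l_less_r[of v] ab C V by (intro rk_less) auto
      show "cmod z = 1 \<and> (Arg z < Arg a \<or> Arg b < Arg z)" if "z \<in> X u" for z
        using out[OF that] rk_less[of z a] rk_less[of b z] XC[OF V(1) that] C ab norm by auto
      show "cmod z = 1 \<and> (z = a \<or> z = b \<or> (Arg a < Arg z \<and> Arg z < Arg b))" if "z \<in> X x" for z
      proof -
        have z: "z \<in> C" "l v \<le> rk z" "rk z \<le> r v"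
          using XC[OF V(3) that] between[OF V(3) that] sub by auto
        then show ?thesis
          using rk_less[of a z] rk_less[of z b] rk_inj[of z a] rk_inj[of z b] C ab norm
          by (metis le_neq_implies_less)
      qed
    qed (use C norm in auto)
    then show ?thesis using corners(2) V by simp
  qed
  show thesis
  proof
    show "0 < l u \<and> l u \<le> r u" if "u \<in> V" for u
      using l[OF that] l_less_r[OF that] by (auto simp: rk_def)
    show "P u \<inter> P v \<noteq> {}" if uv: "u \<in> V" "v \<in> V" "l u < l v \<and> l v \<le> r u \<and> r u < r v" for u v
    proof -
      obtain a b a' b' where "a \<in> X u" "rk a = l u" "b \<in> X u" "rk b = r u"
        "a' \<in> X v" "rk a' = l v" "b' \<in> X v" "rk b' = r v" using l r uv by metis
      with uv show ?thesis by (intro cross[of u v a b a' b']) auto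
    qed
    show "P u \<inter> P v = {}" if "u \<in> V" "v \<in> V" "r u < l v" for u v
      using that between(2)[OF that(1)] by (intro apart[of u v v]) (auto intro: le_less_trans)
    show "P u \<inter> P v \<noteq> {}" if V: "u \<in> V" "v \<in> V" "x \<in> V" and le: "l u \<le> l v"
      "l v \<le> l x" "r x \<le> r v" and meet: "P u \<inter> P x \<noteq> {}" for u v x
    proof -
      \<comment> \<open>If no corner of \<open>u\<close> had its rank between \<open>l v\<close> and
        \<open>r v\<close>, \<open>apart\<close> would separate \<open>u\<close> from
        \<open>x\<close>. The chord from the first corner of \<open>u\<close> to \<open>z\<close>
        then crosses or touches the chord spanning \<open>v\<close>.\<close>
      obtain z where z: "z \<in> X u" "l v \<le> rk z" "rk z \<le> r v"
        using apart[OF V _ le(2,3)] meet by (meson not_less)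
      obtain a a' b' where "a \<in> X u" "rk a = l u" "a' \<in> X v" "rk a' = l v" "b' \<in> X v" "rk b' = r v"
        using l r V by metis
      with z le V show ?thesis by (intro cross[of u v a z a' b']) auto
    qed
  qed
qed

section \<open>Combining the colourings\<close>

lemma polygon_family_colouring:
  fixes P :: "'a \<Rightarrow> complex set"
  assumes "finite V" "0 < w" and poly: "\<And>v. v \<in> V \<Longrightarrow> inscribed_polygon (P v)"
    and cliques: "\<And>K. K \<subseteq> V \<Longrightarrow>
      (\<And>u v. u \<in> K \<Longrightarrow> v \<in> K \<Longrightarrow> u \<noteq> v \<Longrightarrow> P u \<inter> P v \<noteq> {}) \<Longrightarrow> card K \<le> w"
  shows "\<exists>c. (\<forall>u\<in>V. c u < 10 * w ^ 3) \<and>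
    (\<forall>u\<in>V. \<forall>v\<in>V. u \<noteq> v \<longrightarrow> P u \<inter> P v \<noteq> {} \<longrightarrow> c u \<noteq> (c v :: nat))"
proof -
  obtain l r :: "'a \<Rightarrow> nat" where lr: "\<And>u. u \<in> V \<Longrightarrow> 0 < l u \<and> l u \<le> r u"
    and overlap: "\<And>u v. u \<in> V \<Longrightarrow> v \<in> V \<Longrightarrow> l u < l v \<and> l v \<le> r u \<and> r u < r v \<Longrightarrow> P u \<inter> P v \<noteq> {}"
    and disj: "\<And>u v. u \<in> V \<Longrightarrow> v \<in> V \<Longrightarrow> r u < l v \<Longrightarrow> P u \<inter> P v = {}"
    and between: "\<And>u v x. u \<in> V \<Longrightarrow> v \<in> V \<Longrightarrow> x \<in> V \<Longrightarrow> l u \<le> l v \<Longrightarrow> r v \<le> r u \<Longrightarrow>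
      l v \<le> l x \<Longrightarrow> r x \<le> r v \<Longrightarrow> P u \<inter> P x \<noteq> {} \<Longrightarrow> P u \<inter> P v \<noteq> {}"
    by (rule inscribed_polygon_intervals[OF assms(1), where P = P])
      (rule poly, assumption, rule that, assumption+)
  define ov where ov: "ov u v \<longleftrightarrow> l u < l v \<and> l v \<le> r u \<and> r u < r v" for u v
  interpret interval_family V l r w ov
  proof
    show "card K \<le> w"
      if K: "K \<subseteq> V" "\<And>x y. x \<in> K \<Longrightarrow> y \<in> K \<Longrightarrow> x \<noteq> y \<Longrightarrow> ov x y \<or> ov y x" for K
    proof (rule cliques[OF K(1)])
      fix u v assume "u \<in> K" "v \<in> K" "u \<noteq> v"
      then show "P u \<inter> P v \<noteq> {}" using K overlap[of u v] overlap[of v u] unfolding ov by blast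
    qed
  qed (use lr assms in \<open>auto simp: ov\<close>)
  obtain c where c: "\<forall>u\<in>V. c u < 10 * w * w" "\<forall>u\<in>V. \<forall>v\<in>V. ov u v \<longrightarrow> c u \<noteq> c v"
    using overlap_colouring by blast
  define good where "good i h \<longleftrightarrow> (\<forall>u\<in>{u\<in>V. c u = i}. h u < w) \<and>
    (\<forall>u\<in>{u\<in>V. c u = i}. \<forall>v\<in>{u\<in>V. c u = i}.
      u \<noteq> v \<longrightarrow> P u \<inter> P v \<noteq> {} \<longrightarrow> h u \<noteq> (h v :: nat))" for i h
  \<comment> \<open>A colour class of \<open>c\<close> has no overlaps, so its meeting intervals are
    nested.\<close>
  have "\<exists>h. good i h" for i
    unfolding good_def
  proof (rule laminar_colouring[of _ "\<lambda>u v. P u \<inter> P v \<noteq> {}" l r])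
    fix u v assume u: "u \<in> {u\<in>V. c u = i}" and v: "v \<in> {u\<in>V. c u = i}"
    show "l u \<le> r v" if "P u \<inter> P v \<noteq> {}"
      using disj[of v u] that u v by (metis Int_commute mem_Collect_eq not_less)
    assume "l u \<le> r v" "l v \<le> r u"
    moreover have "\<not> ov u v" "\<not> ov v u" using c(2) u v by force+
    ultimately show "(l u \<le> l v \<and> r v \<le> r u) \<or> (l v \<le> l u \<and> r u \<le> r v)"
      unfolding ov by linarith
  next
    fix K assume "K \<subseteq> {u\<in>V. c u = i}"
      "\<And>u v. u \<in> K \<Longrightarrow> v \<in> K \<Longrightarrow> u \<noteq> v \<Longrightarrow> P u \<inter> P v \<noteq> {}"
    then show "card K \<le> w" by (intro cliques) auto
  next
    fix u v x assume "u \<in> {u\<in>V. c u = i}" "v \<in> {u\<in>V. c u = i}" "x \<in> {u\<in>V. c u = i}"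
      "l u \<le> l v" "r v \<le> r u" "l v \<le> l x" "r x \<le> r v" "P u \<inter> P x \<noteq> {}"
    then show "P u \<inter> P v \<noteq> {}" by (intro between[of u v x]) auto
  qed (use lr \<open>finite V\<close> in auto)
  then obtain h where "\<And>i. good i (h i)" by metis
  then have h: "h (c u) u < w" if "u \<in> V" for u
    using that unfolding good_def by blast
  have h_neq: "h (c v) u \<noteq> h (c v) v" if "u \<in> V" "v \<in> V" "c u = c v" "u \<noteq> v" "P u \<inter> P v \<noteq> {}" for u v
    using that \<open>good (c v) (h (c v))\<close> unfolding good_def by blast
  define d where "d u = c u * w + h (c u) u" for u
  have d: "d u div w = c u" "d u mod w = h (c u) u" if "u \<in> V" for u
    using h[OF that] by (auto simp: d_def)
  have "d u < 10 * w ^ 3" if "u \<in> V" for u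
  proof -
    have "d u < 10 * w * w * w"
      using d(1)[OF that] c(1) that \<open>0 < w\<close> by (metis div_less_iff_less_mult)
    then show ?thesis by (simp add: power3_eq_cube mult.assoc)
  qed
  moreover have "d u \<noteq> d v" if "u \<in> V" "v \<in> V" "u \<noteq> v" "P u \<inter> P v \<noteq> {}" for u v
  proof
    assume "d u = d v"
    then have "c u = c v" "h (c u) u = h (c v) v" using d that by metis+
    then show False using h_neq that by metis
  qed
  ultimately show ?thesis by blast
qed

theorem corollary3:
  fixes V :: "'a set" and E :: "'a set set" and \<omega> :: nat
  assumes "polygon_circle_graph V E"
    and "clique_number V E = \<omega>"
  shows "chromatic_number V E \<le> 7 * \<omega> ^ 4"
proof -
  obtain \<P> f where "finite \<P>" "\<forall>P\<in>\<P>. inscribed_polygon P" and f: "bij_betw f V \<P>"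
    and E: "\<forall>e\<in>E. e \<subseteq> V" "(\<lambda>e. f ` e) ` E = intersection_edges \<P>"
    using assms(1) unfolding polygon_circle_graph_def by (elim exE conjE) (rule that)
  have "finite V" using f \<open>finite \<P>\<close> bij_betw_finite by blast
  have poly: "inscribed_polygon (f v)" if "v \<in> V" for v
    using f that \<open>\<forall>P\<in>\<P>. _\<close> by (auto simp: bij_betw_def)
  have edge: "{u, v} \<in> E \<longleftrightarrow> f u \<inter> f v \<noteq> {}" if uv: "u \<in> V" "v \<in> V" "u \<noteq> v" for u v
  proof
    assume "{u, v} \<in> E"
    then have "f ` {u, v} \<in> intersection_edges \<P>" unfolding E(2)[symmetric] by (rule imageI)
    then show "f u \<inter> f v \<noteq> {}"
      unfolding intersection_edges_def by (auto simp: doubleton_eq_iff)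
  next
    assume "f u \<inter> f v \<noteq> {}"
    moreover have "f u \<noteq> f v" "f u \<in> \<P>" "f v \<in> \<P>"
      using f uv by (auto simp: bij_betw_def inj_on_def)
    ultimately have "{f u, f v} \<in> (\<lambda>e. f ` e) ` E"
      unfolding E(2) intersection_edges_def by blast
    then obtain e where e: "e \<in> E" "f ` {u, v} = f ` e" by auto
    \<comment> \<open>Edges lie within \<open>V\<close>, where \<open>f\<close> is injective, so the
      image determines the edge.\<close>
    then have "{u, v} = e"
      using f uv E(1) by (subst (asm) inj_on_image_eq_iff[of f V]) (auto simp: bij_betw_def)
    then show "{u, v} \<in> E" using e by simp
  qed
  have clique_le: "card K \<le> \<omega>" if "K \<subseteq> V" "clique K E" for K
  proof -
    have "{card K | K. K \<subseteq> V \<and> clique K E} \<subseteq> card ` Pow V" by auto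
    then have "finite {card K | K. K \<subseteq> V \<and> clique K E}"
      using \<open>finite V\<close> by (meson finite_Pow_iff finite_imageI finite_subset)
    then show ?thesis
      using that assms(2) unfolding clique_number_def by (auto intro: Max_ge)
  qed
  have chromatic_le: "chromatic_number V E \<le> k"
    if "\<And>v. v \<in> V \<Longrightarrow> c v < k" "proper_colouring V E c" for c k
    unfolding chromatic_number_def using that by (intro Least_le exI[of _ c]) auto
  \<comment> \<open>The final estimate needs \<open>10 \<le> 7 * \<omega>\<close>. For smaller
    clique numbers the graph is empty or has no edges, and 0 or 1 colours suffice.\<close>
  consider "\<omega> = 0" | "\<omega> = 1" | "\<omega> \<ge> 2" by linarith
  then show ?thesis
  proof cases
    case 1
    have "V = {}"
    proof (rule ccontr)
      assume "V \<noteq> {}"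
      then obtain v where "v \<in> V" by blast
      then show False using clique_le[of "{v}"] 1 by (simp add: clique_def)
    qed
    then show ?thesis using chromatic_le[of "\<lambda>_. 0" 0] by (simp add: proper_colouring_def)
  next
    case 2
    have "{u, v} \<notin> E" if "u \<in> V" "v \<in> V" "u \<noteq> v" for u v
      using clique_le[of "{u, v}"] that 2 by (auto simp: clique_def insert_commute)
    then have "chromatic_number V E \<le> 1"
      by (intro chromatic_le[of "\<lambda>_. 0"]) (auto simp: proper_colouring_def)
    then show ?thesis using 2 by simp
  next
    case 3
    have "\<exists>c. (\<forall>u\<in>V. c u < 10 * \<omega> ^ 3) \<and>
        (\<forall>u\<in>V. \<forall>v\<in>V. u \<noteq> v \<longrightarrow> f u \<inter> f v \<noteq> {} \<longrightarrow> c u \<noteq> (c v :: nat))"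
    proof (rule polygon_family_colouring)
      fix K assume K: "K \<subseteq> V" "\<And>u v. u \<in> K \<Longrightarrow> v \<in> K \<Longrightarrow> u \<noteq> v \<Longrightarrow> f u \<inter> f v \<noteq> {}"
      then have "clique K E" using edge unfolding clique_def by blast
      then show "card K \<le> \<omega>" using clique_le K(1) by blast
    qed (use 3 poly \<open>finite V\<close> in auto)
    then obtain c where "\<forall>u\<in>V. c u < 10 * \<omega> ^ 3"
      "\<forall>u\<in>V. \<forall>v\<in>V. u \<noteq> v \<longrightarrow> f u \<inter> f v \<noteq> {} \<longrightarrow> c u \<noteq> (c v :: nat)" by (elim exE conjE) (rule that)
    then have "chromatic_number V E \<le> 10 * \<omega> ^ 3"
      using edge by (intro chromatic_le[of c]) (auto simp: proper_colouring_def)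
    also have "\<dots> \<le> 7 * \<omega> * \<omega> ^ 3" using 3 by (intro mult_right_mono) auto
    also have "\<dots> = 7 * \<omega> ^ 4" by (simp add: power4_eq_xxxx power3_eq_cube)
    finally show ?thesis .
  qed
qed

end
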